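(* (Singleton bound) Let $\mathcal I=(1,m,n,\mathcal X,\mathcal X^{(S)},R)$ be an instance of the ICCSI problem over $\mathbb F_q$ (with $t=1$) and let $\delta\ge0$ be an integer. Then $$\kappa(\mathcal I)+2\delta\le\mathcal N(\mathcal I,\delta).$$
   Context: Notation: $q$ is a prime power, $\mathbb F_q$ the field with $q$ elements, $[m]=\{1,\dots,m\}$. For a matrix $A$, $A_i$ is its $i$-th row and $\langle A\rangle$ its row space. $w$ is the Hamming weight (number of nonzero entries) of a vector. Instance (with $t=1$): positive integers $m,n$; subspaces $\mathcal X^{(S)}$ and $\mathcal X^{(i)}$ ($i\in[m]$) of $\mathbb F_q^n$ of dimensions $d_S$ and $d_i$; $\mathcal X=\{A\in\mathbb F_q^{m\times n}:A_i\in\mathcal X^{(i)}\}$; a matrix $R\in\mathbb F_q^{m\times n}$ with rows $R_i\in\mathcal X^{(S)}\setminus\mathcal X^{(i)}$. Fix $V^{(S)}\in\mathbb F_q^{d_S\times n}$, $V^{(i)}\in\mathbb F_q^{d_i\times n}$ with $\langle V^{(S)}\rangle=\mathcal X^{(S)}$, $\langle V^{(i)}\rangle=\mathcal X^{(i)}$. Error-correcting index codes: $L\in\mathbb F_q^{N\times d_S}$ ($N$ a positive integer) represents an $\mathbb F_q$-linear $(\mathcal I,\delta)$-ECIC of length $N$ if for each $i\in[m]$ there is a map $D_i:\mathbb F_q^N\times\mathbb F_q^{d_i}\to\mathbb F_q$ with $D_i(LV^{(S)}X+W,V^{(i)}X)=R_iX$ for all $X\in\mathbb F_q^n$ and all $W\in\mathbb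 F_q^N$ with $w(W)\le\delta$. $\mathcal N(\mathcal I,\delta)$ is the minimum length $N$ of an $\mathbb F_q$-linear $(\mathcal I,\delta)$-ECIC. The min-rank is $\kappa(\mathcal I)=\min\{\operatorname{rank}(A+R):A\in\mathbb F_q^{m\times n},\ A_i\in\mathcal X^{(i)}\cap\mathcal X^{(S)}\ \forall i\in[m]\}$. *)

theory Defs
  imports "Jordan_Normal_Form.DL_Rank"
begin

text \<open>The finite field is a type of class \<open>{field, finite}\<close>; rows of matrices are indexed from 0,
  so the index set \<open>[m]\<close> is rendered as \<open>i < m\<close>.\<close>

definition is_subspace :: "nat \<Rightarrow> 'a::field vec set \<Rightarrow> bool" where
  "is_subspace n W \<longleftrightarrow> VectorSpace.subspace class_ring W (module_vec TYPE('a) n)"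

definition subspace_dim :: "nat \<Rightarrow> 'a::field vec set \<Rightarrow> nat" where
  "subspace_dim n W = vectorspace.dim class_ring ((module_vec TYPE('a) n)\<lparr>carrier := W\<rparr>)"

definition hamming_weight :: "'a::zero vec \<Rightarrow> nat" where
  "hamming_weight v = card {j. j < dim_vec v \<and> v $ j \<noteq> 0}"

text \<open>The case \<open>t = 1\<close>: the data matrix is a column vector. The set of matrices whose
  \<open>i\<close>-th row lies in \<open>Xi i\<close> is given through the family \<open>Xi\<close>; only \<open>Xi i\<close> with \<open>i < m\<close> matters.\<close>

definition iccsi_instance ::
  "nat \<Rightarrow> nat \<Rightarrow> 'a::field vec set \<Rightarrow> (nat \<Rightarrow> 'a vec set) \<Rightarrow> 'a mat \<Rightarrow> bool" where
  "iccsi_instance m n XS Xi R \<longleftrightarrow>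
     m > 0 \<and> n > 0 \<and> is_subspace n XS \<and> (\<forall>i<m. is_subspace n (Xi i)) \<and>
     R \<in> carrier_mat m n \<and> (\<forall>i<m. row R i \<in> XS - Xi i)"

definition generates :: "nat \<Rightarrow> 'a::field mat \<Rightarrow> 'a vec set \<Rightarrow> bool" where
  "generates n V W \<longleftrightarrow>
     V \<in> carrier_mat (subspace_dim n W) n \<and> vec_space.row_space n V = W"

text \<open>Only the values of the decoding map on vectors of lengths \<open>N\<close> and \<open>dim_row (V i)\<close> are
  constrained.\<close>

definition is_ecic ::
  "nat \<Rightarrow> nat \<Rightarrow> 'a::field mat \<Rightarrow> 'a mat \<Rightarrow> (nat \<Rightarrow> 'a mat) \<Rightarrow> nat \<Rightarrow> nat \<Rightarrow> 'a mat \<Rightarrow> bool" where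
  "is_ecic m n R VS V \<delta> N L \<longleftrightarrow>
     L \<in> carrier_mat N (dim_row VS) \<and>
     (\<forall>i<m. \<exists>D :: 'a vec \<Rightarrow> 'a vec \<Rightarrow> 'a.
        \<forall>X \<in> carrier_vec n. \<forall>W \<in> carrier_vec N. hamming_weight W \<le> \<delta> \<longrightarrow>
          D ((L * VS) *\<^sub>v X + W) (V i *\<^sub>v X) = row R i \<bullet> X)"

definition optimal_length ::
  "nat \<Rightarrow> nat \<Rightarrow> 'a::field mat \<Rightarrow> 'a mat \<Rightarrow> (nat \<Rightarrow> 'a mat) \<Rightarrow> nat \<Rightarrow> nat" where
  "optimal_length m n R VS V \<delta> = (LEAST N. N > 0 \<and> (\<exists>L. is_ecic m n R VS V \<delta> N L))"

definition min_rank ::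
  "nat \<Rightarrow> nat \<Rightarrow> 'a::field vec set \<Rightarrow> (nat \<Rightarrow> 'a vec set) \<Rightarrow> 'a mat \<Rightarrow> nat" where
  "min_rank m n XS Xi R =
     (LEAST k. \<exists>A \<in> carrier_mat m n. (\<forall>i<m. row A i \<in> Xi i \<inter> XS) \<and> k = vec_space.rank m (A + R))"

end

(* If V_i Z = 0 and R_i Z \<noteq> 0, then the codewords of 0 and Z must not be confusable by two errors
   of weight at most \<delta>, so L VS Z has weight at least 2 \<delta> + 1. It remains nonzero when the last
   2 \<delta> coordinates are deleted. By duality R_i is then the sum of a vector of X^(i) and of a
   combination of the first N - 2 \<delta> rows of L VS, and these combinations are the rows of a matrix
   A + R of rank at most N - 2 \<delta>. *)
theory Submission
  imports Defs
begin

section \<open>Linear algebra: double annihilators, rank and row spaces in coordinates\<close>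

text \<open>The double annihilator of a finite family is its span. Induction on the size of the
  family: either the new vector cuts down the common kernel, and then a suitable multiple of it is
  subtracted from \<open>r\<close>, or it does not, and then it gets coefficient 0.\<close>

lemma annihilator_of_kernel:
  fixes f :: "nat \<Rightarrow> 'a::field vec"
  assumes "\<And>i. i < k \<Longrightarrow> f i \<in> carrier_vec n"
    and "r \<in> carrier_vec n"
    and "\<And>Z. Z \<in> carrier_vec n \<Longrightarrow> (\<And>i. i < k \<Longrightarrow> f i \<bullet> Z = 0) \<Longrightarrow> r \<bullet> Z = 0"
  shows "\<exists>c. \<forall>j<n. r $ j = (\<Sum>i<k. c i * f i $ j)"
  using assms
proof (induction k arbitrary: r)
  case 0
  have "r $ j = 0" if "j < n" for j
  proof -
    have "r \<bullet> unit_vec n j = 0" by (rule "0.prems"(3)) auto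
    then show ?thesis using that "0.prems"(2) by simp
  qed
  then show ?case by simp
next
  case (Suc k)
  note f = Suc.prems(1) and r = Suc.prems(2)
  show ?case
  proof (cases "\<exists>Z0 \<in> carrier_vec n. (\<forall>i<k. f i \<bullet> Z0 = 0) \<and> f k \<bullet> Z0 \<noteq> 0")
    case True
    then obtain Z0 where Z0: "Z0 \<in> carrier_vec n" "\<And>i. i < k \<Longrightarrow> f i \<bullet> Z0 = 0" "f k \<bullet> Z0 \<noteq> 0"
      by blast
    \<comment> \<open>With this factor \<open>r - a f k\<close> vanishes at \<open>Z0\<close>, the
      direction that \<open>f k\<close> newly excludes from the kernel.\<close>
    define a where "a = (r \<bullet> Z0) / (f k \<bullet> Z0)"
    have fk: "f k \<in> carrier_vec n" using f by simp
    have "\<exists>c. \<forall>j<n. (r - a \<cdot>\<^sub>v f k) $ j = (\<Sum>i<k. c i * f i $ j)"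
    proof (rule Suc.IH)
      fix Z :: "'a vec" assume Z: "Z \<in> carrier_vec n" and fZ: "\<And>i. i < k \<Longrightarrow> f i \<bullet> Z = 0"
      \<comment> \<open>Moving \<open>Z\<close> along \<open>Z0\<close> by this amount lands in the
        kernel of \<open>f k\<close> without leaving the kernels of the earlier vectors, so the
        hypothesis on \<open>r\<close> applies to \<open>Z - s Z0\<close>.\<close>
      define s where "s = (f k \<bullet> Z) / (f k \<bullet> Z0)"
      have sub: "g \<bullet> (Z - s \<cdot>\<^sub>v Z0) = g \<bullet> Z - s * (g \<bullet> Z0)" if "g \<in> carrier_vec n" for g
        using Z Z0(1) that by (simp add: scalar_prod_minus_distrib[of _ n])
      have "r \<bullet> (Z - s \<cdot>\<^sub>v Z0) = 0"
      proof (rule Suc.prems(3))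
        show "Z - s \<cdot>\<^sub>v Z0 \<in> carrier_vec n" using Z Z0(1) by simp
        fix i assume "i < Suc k"
        then show "f i \<bullet> (Z - s \<cdot>\<^sub>v Z0) = 0"
          using sub[OF f] fZ Z0(2,3) by (cases "i = k") (auto simp: s_def)
      qed
      then have "r \<bullet> Z = s * (r \<bullet> Z0)" using sub[OF r] by simp
      moreover have "(r - a \<cdot>\<^sub>v f k) \<bullet> Z = r \<bullet> Z - a * (f k \<bullet> Z)"
        using r fk Z by (simp add: minus_scalar_prod_distrib[of _ n])
      ultimately show "(r - a \<cdot>\<^sub>v f k) \<bullet> Z = 0" by (simp add: s_def a_def)
    qed (use f r fk in auto)
    then obtain c where c: "\<And>j. j < n \<Longrightarrow> (r - a \<cdot>\<^sub>v f k) $ j = (\<Sum>i<k. c i * f i $ j)"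
      by blast
    have "r $ j = (\<Sum>i<Suc k. (c(k := a)) i * f i $ j)" if "j < n" for j
      using c[OF that] that r fk by (simp add: algebra_simps)
    then show ?thesis by blast
  next
    \<comment> \<open>Here the common kernel of the first \<open>k\<close> vectors already lies in
      that of \<open>f k\<close>.\<close>
    case False
    have "\<exists>c. \<forall>j<n. r $ j = (\<Sum>i<k. c i * f i $ j)"
    proof (rule Suc.IH)
      fix Z :: "'a vec" assume "Z \<in> carrier_vec n" "\<And>i. i < k \<Longrightarrow> f i \<bullet> Z = 0"
      then show "r \<bullet> Z = 0" using False by (intro Suc.prems(3)) (auto simp: less_Suc_eq)
    qed (use f r in auto)
    then obtain c where "\<forall>j<n. r $ j = (\<Sum>i<k. c i * f i $ j)" by blast
    then show ?thesis by (intro exI[of _ "c(k := 0)"]) simp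
  qed
qed

text \<open>A product with inner dimension \<open>p\<close> is a sum of \<open>p\<close> outer
  products, and each of them adds at most 1 to the rank.\<close>

lemma rank_le_factorization:
  fixes A :: "'a::field mat"
  assumes "A \<in> carrier_mat m n"
    and "\<And>i j. i < m \<Longrightarrow> j < n \<Longrightarrow> A $$ (i, j) = (\<Sum>k<p. b i k * c k j)"
  shows "vec_space.rank m A \<le> p"
  using assms
proof (induction p arbitrary: A)
  case 0
  then have "A = 0\<^sub>m m n" by auto
  then show ?case by (simp add: vec_space.rank_0I)
next
  case (Suc p)
  define A1 where "A1 = mat m n (\<lambda>(i, j). \<Sum>k<p. b i k * c k j)"
  define A2 where "A2 = mat m n (\<lambda>(i, j). b i p * c p j)"
  have carr: "A1 \<in> carrier_mat m n" "A2 \<in> carrier_mat m n"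
    by (simp_all add: A1_def A2_def)
  have "vec_space.rank m A1 \<le> p"
    using carr(1) by (rule Suc.IH) (simp add: A1_def)
  moreover have "vec_space.rank m A2 \<le> 1"
    using vec_space.rank_le_1_product_entries[OF carr(2), of "\<lambda>i. b i p" "c p"]
    by (simp add: A2_def)
  moreover have "A = A1 + A2"
    using Suc.prems by (intro eq_matI) (auto simp: A1_def A2_def)
  moreover have "vec_space.rank m (A1 + A2) \<le> vec_space.rank m A1 + vec_space.rank m A2"
    using carr by (rule vec_space.rank_subadditive)
  ultimately show ?case by simp
qed

text \<open>Translates row spaces into the coordinate form that \<open>annihilator_of_kernel\<close>
  produces, with coefficients given by a function instead of a vector.\<close>

lemma mem_row_space_iff:
  fixes V :: "'a::field mat"
  assumes "V \<in> carrier_mat d n"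
  shows "w \<in> vec_space.row_space n V \<longleftrightarrow>
    w \<in> carrier_vec n \<and> (\<exists>c. \<forall>j<n. w $ j = (\<Sum>i<d. c i * V $$ (i, j)))"
proof -
  have entry: "(V\<^sup>T *\<^sub>v y) $ j = (\<Sum>i<d. y $ i * V $$ (i, j))"
    if "y \<in> carrier_vec d" "j < n" for y j
    using that assms by (auto simp: scalar_prod_def atLeast0LessThan mult.commute intro!: sum.cong)
  have "(\<exists>y\<in>carrier_vec d. V\<^sup>T *\<^sub>v y = w) \<longleftrightarrow> (\<exists>c. \<forall>j<n. w $ j = (\<Sum>i<d. c i * V $$ (i, j)))"
    if w: "w \<in> carrier_vec n"
  proof
    assume "\<exists>y\<in>carrier_vec d. V\<^sup>T *\<^sub>v y = w"
    then obtain y where "y \<in> carrier_vec d" "V\<^sup>T *\<^sub>v y = w" by blast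
    then show "\<exists>c. \<forall>j<n. w $ j = (\<Sum>i<d. c i * V $$ (i, j))"
      using entry by (intro exI[of _ "\<lambda>i. y $ i"]) auto
  next
    assume "\<exists>c. \<forall>j<n. w $ j = (\<Sum>i<d. c i * V $$ (i, j))"
    then obtain c where c: "\<forall>j<n. w $ j = (\<Sum>i<d. c i * V $$ (i, j))" by blast
    have "V\<^sup>T *\<^sub>v vec d c = w"
    proof (rule eq_vecI)
      fix j assume "j < dim_vec w"
      then show "(V\<^sup>T *\<^sub>v vec d c) $ j = w $ j"
        using entry[of "vec d c" j] c w by simp
    qed (use assms w in auto)
    then show "\<exists>y\<in>carrier_vec d. V\<^sup>T *\<^sub>v y = w" by (intro bexI[of _ "vec d c"]) auto
  qed
  then show ?thesis
    using assms vec_space.row_space_eq[OF assms] by auto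
qed

section \<open>Error patterns and decodability\<close>

text \<open>Part of the support of \<open>u\<close> is cancelled by \<open>W1\<close> and the rest
  survives as \<open>W2\<close>; thus the words \<open>u\<close> and 0 can both be received as
  \<open>W2\<close>.\<close>

lemma split_hamming_weight:
  fixes u :: "'a::field vec"
  assumes u: "u \<in> carrier_vec N" and "hamming_weight u \<le> 2 * \<delta>"
  obtains W1 W2 where "W1 \<in> carrier_vec N" "W2 \<in> carrier_vec N"
    "hamming_weight W1 \<le> \<delta>" "hamming_weight W2 \<le> \<delta>" "u + W1 = W2"
proof -
  define J where "J = {j. j < N \<and> u $ j \<noteq> 0}"
  have J: "finite J" "card J \<le> 2 * \<delta>" using assms by (auto simp: J_def hamming_weight_def)
  \<comment> \<open>The minimum covers supports with fewer than \<delta> elements; in either case at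
    most \<delta> positions remain outside \<open>K\<close>.\<close>
  obtain K where K: "K \<subseteq> J" "card K = min \<delta> (card J)" "finite K"
    using obtain_subset_with_card_n[of "min \<delta> (card J)" J] by auto
  define W1 where "W1 = vec N (\<lambda>j. if j \<in> K then - u $ j else 0)"
  define W2 where "W2 = vec N (\<lambda>j. if j \<in> K then 0 else u $ j)"
  show ?thesis
  proof
    show "W1 \<in> carrier_vec N" "W2 \<in> carrier_vec N" by (simp_all add: W1_def W2_def)
    have "hamming_weight W1 \<le> card K"
      unfolding hamming_weight_def
      by (rule card_mono[OF K(3)]) (auto simp: W1_def split: if_splits)
    then show "hamming_weight W1 \<le> \<delta>" using K(2) by simp
    have "hamming_weight W2 \<le> card (J - K)"
      unfolding hamming_weight_def
      using J(1) by (intro card_mono) (auto simp: W2_def J_def split: if_splits)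
    also have "\<dots> = card J - card K" using K by (simp add: card_Diff_subset)
    finally show "hamming_weight W2 \<le> \<delta>" using K(2) J(2) by simp
    show "u + W1 = W2" using u by (intro eq_vecI) (auto simp: W1_def W2_def)
  qed
qed

text \<open>The messages \<open>Z\<close> and 0 give receiver \<open>i\<close> the same side
  information and, under suitable errors, the same received word. The decoder must therefore return
  the same value for both, and for 0 this value is 0.\<close>

lemma ecic_kernel:
  fixes R VS L :: "'a::field mat"
  assumes ecic: "is_ecic m n R VS V \<delta> N L" and i: "i < m"
    and VS: "VS \<in> carrier_mat d n" and Vi: "V i \<in> carrier_mat e n" and R: "R \<in> carrier_mat m n"
    and Z: "Z \<in> carrier_vec n" and VZ: "V i *\<^sub>v Z = 0\<^sub>v e"
    and wt: "hamming_weight ((L * VS) *\<^sub>v Z) \<le> 2 * \<delta>"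
  shows "row R i \<bullet> Z = 0"
proof -
  have L: "L * VS \<in> carrier_mat N n" using ecic VS by (auto simp: is_ecic_def)
  have "(L * VS) *\<^sub>v Z \<in> carrier_vec N" using L Z by simp
  then obtain W1 W2 where W: "W1 \<in> carrier_vec N" "W2 \<in> carrier_vec N"
    "hamming_weight W1 \<le> \<delta>" "hamming_weight W2 \<le> \<delta>" "(L * VS) *\<^sub>v Z + W1 = W2"
    using split_hamming_weight[OF _ wt] by blast
  obtain D where D: "\<And>X W. X \<in> carrier_vec n \<Longrightarrow> W \<in> carrier_vec N \<Longrightarrow> hamming_weight W \<le> \<delta> \<Longrightarrow>
    D ((L * VS) *\<^sub>v X + W) (V i *\<^sub>v X) = row R i \<bullet> X"
    using ecic i unfolding is_ecic_def by blast
  have zero: "(L * VS) *\<^sub>v 0\<^sub>v n = 0\<^sub>v N" "V i *\<^sub>v 0\<^sub>v n = 0\<^sub>v e"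
    using L Vi by (auto intro!: eq_vecI simp del: index_mult_mat(2))
  have "row R i \<bullet> Z = D W2 (0\<^sub>v e)" using D[OF Z W(1,3)] W(5) VZ by simp
  also have "\<dots> = row R i \<bullet> 0\<^sub>v n" using D[OF zero_carrier_vec W(2,4)] W(2) zero by simp
  also have "\<dots> = 0" using R i by (intro scalar_prod_right_zero) auto
  finally show ?thesis .
qed

text \<open>A converse of \<open>ecic_kernel\<close> for receivers that ignore their side
  information. Two messages with a common received word differ by some \<open>Z\<close> whose
  encoding has weight at most 2 \<delta>, so they agree on the demand.\<close>

lemma ecic_of_kernel:
  fixes R VS L :: "'a::field mat"
  assumes L: "L \<in> carrier_mat N d" and VS: "VS \<in> carrier_mat d n" and R: "R \<in> carrier_mat m n"
    and ker: "\<And>i Z. i < m \<Longrightarrow> Z \<in> carrier_vec n \<Longrightarrow>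
      hamming_weight ((L * VS) *\<^sub>v Z) \<le> 2 * \<delta> \<Longrightarrow> row R i \<bullet> Z = 0"
  shows "is_ecic m n R VS V \<delta> N L"
  unfolding is_ecic_def
proof (intro conjI allI impI)
  show "L \<in> carrier_mat N (dim_row VS)" using L VS by simp
  fix i assume i: "i < m"
  let ?G = "L * VS"
  have G: "?G \<in> carrier_mat N n" using L VS by simp
  have uniq: "row R i \<bullet> X = row R i \<bullet> X'"
    if X: "X \<in> carrier_vec n" "X' \<in> carrier_vec n" and W: "W \<in> carrier_vec N" "W' \<in> carrier_vec N"
      and wt: "hamming_weight W \<le> \<delta>" "hamming_weight W' \<le> \<delta>"
      and eq: "?G *\<^sub>v X + W = ?G *\<^sub>v X' + W'" for X X' W W'
  proof -
    \<comment> \<open>The two codewords differ exactly by the difference of the errors, so the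
      support of this difference lies in the union of the two error supports.\<close>
    have "(?G *\<^sub>v (X - X')) $ j = W' $ j - W $ j" if "j < N" for j
    proof -
      have "(?G *\<^sub>v X + W) $ j = (?G *\<^sub>v X' + W') $ j" using eq by simp
      then show ?thesis
        using that G L X W by (simp add: mult_minus_distrib_mat_vec[OF G] algebra_simps)
    qed
    then have "hamming_weight (?G *\<^sub>v (X - X'))
        \<le> card ({j. j < dim_vec W \<and> W $ j \<noteq> 0} \<union> {j. j < dim_vec W' \<and> W' $ j \<noteq> 0})"
      unfolding hamming_weight_def using G W by (intro card_mono) auto
    also have "\<dots> \<le> hamming_weight W + hamming_weight W'"
      unfolding hamming_weight_def by (rule card_Un_le)
    finally have "row R i \<bullet> (X - X') = 0" using wt X i by (intro ker) auto
    moreover have "row R i \<in> carrier_vec n" using R i by simp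
    ultimately show ?thesis using X by (simp add: scalar_prod_minus_distrib[of _ n])
  qed
  \<comment> \<open>Decoding by choice of a consistent message; \<open>uniq\<close> makes the value
    independent of that choice. Words that cannot be received get an arbitrary value.\<close>
  define D where "D = (\<lambda>y (z :: 'a vec). SOME a. \<exists>X\<in>carrier_vec n. \<exists>W\<in>carrier_vec N.
    hamming_weight W \<le> \<delta> \<and> y = ?G *\<^sub>v X + W \<and> a = row R i \<bullet> X)"
  show "\<exists>D. \<forall>X\<in>carrier_vec n. \<forall>W\<in>carrier_vec N. hamming_weight W \<le> \<delta> \<longrightarrow>
    D (?G *\<^sub>v X + W) (V i *\<^sub>v X) = row R i \<bullet> X"
  proof (intro exI[of _ D] ballI impI)
    fix X W :: "'a vec"
    assume XW: "X \<in> carrier_vec n" "W \<in> carrier_vec N" "hamming_weight W \<le> \<delta>"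
    show "D (?G *\<^sub>v X + W) (V i *\<^sub>v X) = row R i \<bullet> X"
      unfolding D_def
    proof (rule some_equality)
      show "\<exists>X'\<in>carrier_vec n. \<exists>W'\<in>carrier_vec N. hamming_weight W' \<le> \<delta> \<and>
        ?G *\<^sub>v X + W = ?G *\<^sub>v X' + W' \<and> row R i \<bullet> X = row R i \<bullet> X'"
        using XW by blast
    next
      fix a assume "\<exists>X'\<in>carrier_vec n. \<exists>W'\<in>carrier_vec N. hamming_weight W' \<le> \<delta> \<and>
        ?G *\<^sub>v X + W = ?G *\<^sub>v X' + W' \<and> a = row R i \<bullet> X'"
      then obtain X' W' where "X' \<in> carrier_vec n" "W' \<in> carrier_vec N" "hamming_weight W' \<le> \<delta>"
        "?G *\<^sub>v X + W = ?G *\<^sub>v X' + W'" "a = row R i \<bullet> X'" by blast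
      then show "a = row R i \<bullet> X" using uniq[of X X' W W'] XW by simp
    qed
  qed
qed

text \<open>Repetition code: row \<open>k\<close> of \<open>L\<close> is \<open>unit_vec d (k mod (d + 1))\<close>, so that every
  coordinate of \<open>VS X\<close> is sent \<open>2 * \<delta> + 1\<close> times. The extra zero row
  \<open>unit_vec d d = 0\<close> keeps the length positive for \<open>d = 0\<close>.\<close>
lemma ecic_exists:
  fixes R VS :: "'a::field mat"
  assumes VS: "VS \<in> carrier_mat d n" and R: "R \<in> carrier_mat m n"
    and rows: "\<And>i. i < m \<Longrightarrow> row R i \<in> vec_space.row_space n VS"
  shows "\<exists>N>0. \<exists>L. is_ecic m n R VS V \<delta> N L"
proof -
  define N where "N = (d + 1) * (2 * \<delta> + 1)"
  define L :: "'a mat" where "L = mat N d (\<lambda>(k, l). if k mod (d + 1) = l then 1 else 0)"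
  have L: "L \<in> carrier_mat N d" by (simp add: L_def)
  have "is_ecic m n R VS V \<delta> N L"
  proof (rule ecic_of_kernel[OF L VS R])
    fix i and Z :: "'a vec"
    assume i: "i < m" and Z: "Z \<in> carrier_vec n"
      and wt: "hamming_weight ((L * VS) *\<^sub>v Z) \<le> 2 * \<delta>"
    have G: "((L * VS) *\<^sub>v Z) $ k = (VS *\<^sub>v Z) $ (k mod (d + 1))"
      if "k < N" "k mod (d + 1) < d" for k
    proof -
      have "(L * VS) *\<^sub>v Z = L *\<^sub>v (VS *\<^sub>v Z)" using L VS Z by simp
      moreover have "row L k = unit_vec d (k mod (d + 1))"
        using that by (intro eq_vecI) (auto simp: L_def)
      ultimately show ?thesis
        using that L VS Z by simp
    qed
    have VSZ: "(VS *\<^sub>v Z) $ l = 0" if l: "l < d" for l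
    proof (rule ccontr)
      assume nz: "(VS *\<^sub>v Z) $ l \<noteq> 0"
      \<comment> \<open>The 2 \<delta> + 1 positions at which coordinate \<open>l\<close> is
        repeated; if that coordinate were nonzero, all of them would count towards the
        weight.\<close>
      let ?h = "\<lambda>q. l + (d + 1) * q"
      have "?h ` {..2 * \<delta>} \<subseteq> {k. k < N \<and> ((L * VS) *\<^sub>v Z) $ k \<noteq> 0}"
      proof
        fix k assume "k \<in> ?h ` {..2 * \<delta>}"
        then obtain q where q: "q \<le> 2 * \<delta>" "k = l + (d + 1) * q" by auto
        have "k < (d + 1) * (q + 1)" using q l by (simp add: algebra_simps)
        also have "\<dots> \<le> N" unfolding N_def using q by (intro mult_le_mono) auto
        finally have "k < N" .
        moreover have "k mod (d + 1) = l" using q(2) l by (simp only: mod_mult_self2) simp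
        ultimately show "k \<in> {k. k < N \<and> ((L * VS) *\<^sub>v Z) $ k \<noteq> 0}"
          using G[of k] nz l by simp
      qed
      then have "card (?h ` {..2 * \<delta>}) \<le> card {k. k < N \<and> ((L * VS) *\<^sub>v Z) $ k \<noteq> 0}"
        by (intro card_mono) auto
      moreover have "card (?h ` {..2 * \<delta>}) = 2 * \<delta> + 1"
        by (subst card_image) (auto simp: inj_on_def simp del: mult_Suc)
      ultimately show False using wt L by (simp add: hamming_weight_def)
    qed
    \<comment> \<open>The demand is a combination of the rows of \<open>VS\<close>, hence vanishes
      wherever \<open>VS\<close> does.\<close>
    obtain c where c: "\<And>j. j < n \<Longrightarrow> row R i $ j = (\<Sum>l<d. c l * VS $$ (l, j))"
      using rows[OF i] mem_row_space_iff[OF VS] by blast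
    have "row R i \<bullet> Z = (\<Sum>j<n. \<Sum>l<d. c l * (VS $$ (l, j) * Z $ j))"
      using Z c by (auto simp: scalar_prod_def atLeast0LessThan sum_distrib_right mult.assoc intro!: sum.cong)
    also have "\<dots> = (\<Sum>l<d. c l * (VS *\<^sub>v Z) $ l)"
      using VS Z by (subst sum.swap)
        (auto simp: scalar_prod_def atLeast0LessThan sum_distrib_left intro!: sum.cong)
    also have "\<dots> = 0" using VSZ by simp
    finally show "row R i \<bullet> Z = 0" .
  qed
  then show ?thesis by (intro exI[of _ N]) (auto simp: N_def)
qed

section \<open>The bound for an arbitrary code\<close>

lemma ecic_singleton_bound:
  fixes R VS L :: "'a::field mat"
  assumes ecic: "is_ecic m n R VS V \<delta> N L"
    and m: "m > 0" and R: "R \<in> carrier_mat m n"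
    and rows: "\<And>i. i < m \<Longrightarrow> row R i \<in> XS - Xi i"
    and VS: "VS \<in> carrier_mat d n" and XS: "vec_space.row_space n VS = XS"
    and V: "\<And>i. i < m \<Longrightarrow> V i \<in> carrier_mat (e i) n"
    and Xi: "\<And>i. i < m \<Longrightarrow> vec_space.row_space n (V i) = Xi i"
  shows "min_rank m n XS Xi R + 2 * \<delta> \<le> N"
proof -
  let ?G = "L * VS"
  define p where "p = N - 2 * \<delta>"
  have L: "L \<in> carrier_mat N d" using ecic VS by (simp add: is_ecic_def)
  have G: "?G \<in> carrier_mat N n" using L VS by simp
  have VZ: "V i *\<^sub>v Z = 0\<^sub>v (e i)"
    if "i < m" "\<And>k. k < e i \<Longrightarrow> row (V i) k \<bullet> Z = 0" for i Z
    using that V[of i] by (intro eq_vecI) auto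
  have Rc: "row R i \<in> carrier_vec n" if "i < m" for i using R that by simp

  \<comment> \<open>This rules out truncation in \<open>p\<close>. In a shorter code every word has
    weight at most 2 \<delta>, so \<open>row R 0\<close> would vanish on the kernel of
    \<open>V 0\<close> and lie in \<open>Xi 0\<close>, which the instance forbids;
    \<open>m > 0\<close> supplies this receiver.\<close>
  have "2 * \<delta> < N"
  proof (rule ccontr)
    assume small: "\<not> 2 * \<delta> < N"
    have "\<exists>c. \<forall>j<n. row R 0 $ j = (\<Sum>k<e 0. c k * row (V 0) k $ j)"
    proof (rule annihilator_of_kernel)
      fix Z :: "'a vec" assume Z: "Z \<in> carrier_vec n" "\<And>k. k < e 0 \<Longrightarrow> row (V 0) k \<bullet> Z = 0"
      have "hamming_weight (?G *\<^sub>v Z) \<le> card {..<N}"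
        unfolding hamming_weight_def using G by (intro card_mono) auto
      then show "row R 0 \<bullet> Z = 0"
        using ecic_kernel[OF ecic m VS V[OF m] R Z(1) VZ[OF m Z(2)]] small by simp
    qed (use V[OF m] Rc[OF m] in auto)
    then have "row R 0 \<in> vec_space.row_space n (V 0)"
      using V[OF m] Rc[OF m] by (simp add: mem_row_space_iff[OF V[OF m]] cong: conj_cong)
    then show False using rows[OF m] Xi[OF m] by simp
  qed

  have "\<exists>a y. \<forall>j<n. row R i $ j = (\<Sum>k<e i. a k * V i $$ (k, j)) + (\<Sum>k<p. y k * ?G $$ (k, j))"
    if i: "i < m" for i
  proof -
    \<comment> \<open>The rows of \<open>V i\<close> followed by the first \<open>p\<close> rows of
      \<open>L * VS\<close>, as one family for the duality lemma.\<close>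
    define f where "f k = (if k < e i then row (V i) k else row ?G (k - e i))" for k
    have "\<exists>c. \<forall>j<n. row R i $ j = (\<Sum>k<e i + p. c k * f k $ j)"
    proof (rule annihilator_of_kernel)
      fix k assume "k < e i + p"
      then show "f k \<in> carrier_vec n" using V[OF i] G L VS
        by (auto simp: f_def p_def intro!: carrier_vecI)
    next
      fix Z :: "'a vec" assume Z: "Z \<in> carrier_vec n" "\<And>k. k < e i + p \<Longrightarrow> f k \<bullet> Z = 0"
      have "row (V i) k \<bullet> Z = 0" if "k < e i" for k using Z(2)[of k] that by (simp add: f_def)
      \<comment> \<open>Orthogonality to the retained rows confines the support to the deleted
        positions, of which there are at most 2 \<delta>.\<close>
      moreover have "hamming_weight (?G *\<^sub>v Z) \<le> card {p..<N}"
      proof -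
        have zero: "(?G *\<^sub>v Z) $ k = 0" if "k < p" for k
          using Z(2)[of "e i + k"] that G L VS by (simp add: f_def p_def)
        have "{k. k < dim_vec (?G *\<^sub>v Z) \<and> (?G *\<^sub>v Z) $ k \<noteq> 0} \<subseteq> {p..<N}"
        proof
          fix k assume "k \<in> {k. k < dim_vec (?G *\<^sub>v Z) \<and> (?G *\<^sub>v Z) $ k \<noteq> 0}"
          then show "k \<in> {p..<N}" using zero[of k] L by (cases "k < p") auto
        qed
        then show ?thesis unfolding hamming_weight_def by (intro card_mono) auto
      qed
      ultimately show "row R i \<bullet> Z = 0"
        by (intro ecic_kernel[OF ecic i VS V[OF i] R Z(1) VZ[OF i]]) (auto simp: p_def)
    qed (rule Rc[OF i])
    then obtain c where c: "\<And>j. j < n \<Longrightarrow> row R i $ j = (\<Sum>k<e i + p. c k * f k $ j)" by blast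
    have split: "(\<Sum>k<e i + p. h k) = (\<Sum>k<e i. h k) + (\<Sum>k<p. h (e i + k))" for h :: "nat \<Rightarrow> 'a"
      by (induction p) (simp_all add: add.assoc)
    have "row R i $ j = (\<Sum>k<e i. c k * V i $$ (k, j)) + (\<Sum>k<p. c (e i + k) * ?G $$ (k, j))"
      if "j < n" for j
      unfolding c[OF that] split using that V[OF i] G L VS
      by (intro arg_cong2[of _ _ _ _ "(+)"] sum.cong) (auto simp: f_def p_def)
    then show ?thesis by (intro exI allI impI)
  qed
  \<comment> \<open>The coefficients are chosen for all receivers at once, so that \<open>y\<close>
    can serve as the left factor of a matrix product.\<close>
  then have "\<forall>i\<in>{..<m}. \<exists>a y. \<forall>j<n. row R i $ j =
    (\<Sum>k<e i. a k * V i $$ (k, j)) + (\<Sum>k<p. y k * ?G $$ (k, j))" by blast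
  from bchoice[OF this] obtain a where "\<forall>i\<in>{..<m}. \<exists>y. \<forall>j<n. row R i $ j =
    (\<Sum>k<e i. a i k * V i $$ (k, j)) + (\<Sum>k<p. y k * ?G $$ (k, j))" by blast
  from bchoice[OF this] obtain y where ay: "\<And>i j. i < m \<Longrightarrow> j < n \<Longrightarrow>
    row R i $ j = (\<Sum>k<e i. a i k * V i $$ (k, j)) + (\<Sum>k<p. y i k * ?G $$ (k, j))"
    by blast

  \<comment> \<open>Defined so that \<open>A + R\<close> is the product of \<open>y\<close> with the
    first \<open>p\<close> rows of \<open>L * VS\<close>. By \<open>ay\<close>, row \<open>i\<close>
    of \<open>A\<close> is then minus the side-information part of \<open>row R i\<close>.\<close>
  define A where "A = mat m n (\<lambda>(i, j). (\<Sum>k<p. y i k * ?G $$ (k, j)) - R $$ (i, j))"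
  have A: "A \<in> carrier_mat m n" by (simp add: A_def)
  have "row A i \<in> Xi i \<inter> XS" if i: "i < m" for i
  proof
    have "row A i $ j = (\<Sum>k<e i. - a i k * V i $$ (k, j))" if "j < n" for j
      using ay[OF i that] R i that by (simp add: A_def sum_negf)
    then show "row A i \<in> Xi i"
      unfolding Xi[OF i, symmetric] mem_row_space_iff[OF V[OF i]] using A i
      by (intro conjI exI[of _ "\<lambda>k. - a i k"]) auto
    obtain z where z: "\<And>j. j < n \<Longrightarrow> row R i $ j = (\<Sum>l<d. z l * VS $$ (l, j))"
      using rows[OF i] unfolding XS[symmetric] using mem_row_space_iff[OF VS] by blast
    \<comment> \<open>Both terms of \<open>A\<close> lie in the row space of \<open>VS\<close>: the
      first through the encoding matrix \<open>L\<close>, the second through the coefficients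
      \<open>z\<close> of the demand.\<close>
    have "row A i $ j = (\<Sum>l<d. ((\<Sum>k<p. y i k * L $$ (k, l)) - z l) * VS $$ (l, j))"
      if j: "j < n" for j
    proof -
      have "(\<Sum>k<p. y i k * ?G $$ (k, j)) = (\<Sum>k<p. \<Sum>l<d. y i k * L $$ (k, l) * VS $$ (l, j))"
        using L VS j by (intro sum.cong)
          (auto simp: p_def scalar_prod_def atLeast0LessThan sum_distrib_left mult.assoc intro!: sum.cong)
      also have "\<dots> = (\<Sum>l<d. (\<Sum>k<p. y i k * L $$ (k, l)) * VS $$ (l, j))"
        by (subst sum.swap) (simp add: sum_distrib_right)
      finally show ?thesis
        using z[OF j] R i j by (simp add: A_def left_diff_distrib sum_subtractf)
    qed
    then show "row A i \<in> XS"
      unfolding XS[symmetric] mem_row_space_iff[OF VS] using A i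
      by (intro conjI exI[of _ "\<lambda>l. (\<Sum>k<p. y i k * L $$ (k, l)) - z l"]) auto
  qed
  have "vec_space.rank m (A + R) \<le> p"
    using A R by (intro rank_le_factorization[where n = n and b = y and c = "\<lambda>k j. ?G $$ (k, j)"])
      (auto simp: A_def)
  moreover have "min_rank m n XS Xi R \<le> vec_space.rank m (A + R)"
    unfolding min_rank_def using A \<open>\<And>i. i < m \<Longrightarrow> row A i \<in> Xi i \<inter> XS\<close>
    by (intro Least_le) blast
  ultimately have "min_rank m n XS Xi R \<le> p" by linarith
  then show ?thesis using \<open>2 * \<delta> < N\<close> by (simp add: p_def)
qed

theorem mainTheorem9:
  fixes m n \<delta> :: nat
    and XS :: "'a::{field,finite} vec set" and Xi :: "nat \<Rightarrow> 'a vec set"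
    and R VS :: "'a mat" and V :: "nat \<Rightarrow> 'a mat"
  assumes "iccsi_instance m n XS Xi R"
    and "generates n VS XS"
    and "\<And>i. i < m \<Longrightarrow> generates n (V i) (Xi i)"
  shows "min_rank m n XS Xi R + 2 * \<delta> \<le> optimal_length m n R VS V \<delta>"
proof -
  have inst: "m > 0" "R \<in> carrier_mat m n" "\<And>i. i < m \<Longrightarrow> row R i \<in> XS - Xi i"
    using assms(1) by (auto simp: iccsi_instance_def)
  have VS: "VS \<in> carrier_mat (subspace_dim n XS) n" "vec_space.row_space n VS = XS"
    using assms(2) by (auto simp: generates_def)
  have V: "V i \<in> carrier_mat (subspace_dim n (Xi i)) n" "vec_space.row_space n (V i) = Xi i"
    if "i < m" for i using assms(3)[OF that] by (auto simp: generates_def)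
  \<comment> \<open>The \<open>LEAST\<close> in \<open>optimal_length\<close> is attained only if
    some code of positive length exists; the repetition code provides one.\<close>
  have "\<exists>N. N > 0 \<and> (\<exists>L. is_ecic m n R VS V \<delta> N L)"
    using inst(3) VS(2) by (intro ecic_exists[OF VS(1) inst(2)]) auto
  then have "\<exists>L. is_ecic m n R VS V \<delta> (optimal_length m n R VS V \<delta>) L"
    unfolding optimal_length_def by (rule LeastI2_ex) blast
  then obtain L where "is_ecic m n R VS V \<delta> (optimal_length m n R VS V \<delta>) L" by blast
  then show ?thesis
    by (rule ecic_singleton_bound[OF _ inst VS V])
qed

end
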